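(* Let $T$ be $\sigma$-strongly monotone for some $\sigma>0$, i.e. $(u-v)^{\mathsf T}(\mathbf{x}-\mathbf{y})\ge\sigma\|\mathbf{x}-\mathbf{y}\|^2$ for all $\mathbf{x},\mathbf{y}\in\mathbb{R}^n$, $u\in T(\mathbf{x})$, $v\in T(\mathbf{y})$, and let a stochastic first-order oracle for $T$ with state-dependent moment bounds be available (as described in the context). Let $\{\mathbf{x}^k\}$ be a sequence generated by the scheme (VR-SPP) described in the context, let $\mathbf{x}^*$ be the unique solution of $0\in T(\mathbf{x})$, and suppose $\|\mathbf{x}^0-\mathbf{x}^*\|\le M$. Then: (a) Suppose $N_k=\lfloor\rho^{-(k+1)}\rfloor$ for all $k\ge 0$, where $0<\rho<1$, and let $q=\tfrac{1+d}{(1+\sigma\lambda)^2}<1$ with $d>0$ sufficiently small. Then there is a constant $\tilde D>0$ such that $\mathbb{E}[\|\mathbf{x}^k-\mathbf{x}^*\|^2]\le\tilde D\tilde\rho^{\,k}$, where $\tilde\rho=\max\{q,\rho\}$ if $q\neq\rho$, and $\tilde\rho\in(q,1)$ if $q=\rho$. (b) With $N_k$ chosen as in (a), the oracle complexity (total number $\sum_{k=0}^KN_k$ of oracle calls) to ensure $\mathbb{E}[\|\mathbf{x}^{K+1}-\mathbf{x}^*\|^2]\le\epsilon$ satisfies $\sum_{k=0}^KN_k\le\mathcal{O}\!\left(\tfrac1\epsilon\right)$.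
   Context: Game. There are $\mathbf{N}$ players; player $i$ has a closed convex strategy set $\mathcal{X}_i\subseteq\mathbb{R}^{n_i}$, $\sum_i n_i=n$, $\mathcal{X}=\prod_i\mathcal{X}_i$. Given $\mathbf{x}^{-i}=(\mathbf{x}^j)_{j\ne i}$, player $i$ minimizes over $\mathbf{x}^i\in\mathcal{X}_i$ the function $\mathbb{E}[\tilde f_i(\mathbf{x}^i,\mathbf{x}^{-i},\mathbf{y}^i(\mathbf{x},\omega),\omega)]$, where $\mathbf{y}^i(\mathbf{x},\omega)$ is the unique solution of the lower-level variational inequality $\mathrm{VI}(\mathcal{Y}_i,F_i(\cdot,\mathbf{x},\omega))$ with $\mathcal{Y}_i$ closed convex and $F_i(\cdot,\mathbf{x},\omega)$ strongly monotone for every $\mathbf{x}\in\mathcal{X}$ and $\omega$; for each $\omega$ and each $\mathbf{x}^{-i}$, the implicit function $\mathbf{x}^i\mapsto\tilde f_i(\mathbf{x}^i,\mathbf{x}^{-i},\mathbf{y}^i(\mathbf{x},\omega),\omega)$ is convex on $\mathcal{X}_i$. Set $\Phi(\mathbf{x},\mathbf{y}(\mathbf{x},\omega),\omega)=\prod_{i=1}^{\mathbf{N}}[\partial_{\mathbf{x}^i}\tilde f_i(\mathbf{x}^i,\mathbf{x}^{-i},\mathbf{y}^i(\mathbf{x},\omega),\omega)+\mathcal{N}_{\mathcal{X}_i}(\mathbf{x}^i)]$ (normal cone $\mathcal{N}$; subdifferential of the implicit function in $\mathbf{x}^i$) and $T(\mathbf{x})=\mathbb{E}[\Phi(\mathbf{x},\mathbf{y}(\mathbf{x},\omega),\omega)]$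 (Aumann expectation). $T:\mathbb{R}^n\rightrightarrows\mathbb{R}^n$ is maximal monotone (standing assumption), and the game has a Nash equilibrium, so $T^{-1}(0)\neq\emptyset$. Oracle. There are constants $M_1,M_2$ such that, given any $\mathbf{x}$, the oracle returns $v(\mathbf{x},\omega)\in\Phi(\mathbf{x},\mathbf{y}(\mathbf{x},\omega),\omega)$ with $\mathbb{E}[v(\mathbf{x},\omega)\mid\mathbf{x}]=v(\mathbf{x})\in T(\mathbf{x})$ and $\mathbb{E}[\|v(\mathbf{x},\omega)\|^2\mid\mathbf{x}]\le M_1^2\|\mathbf{x}\|^2+M_2^2$ a.s. Scheme (VR-SPP). Given (deterministic) $\mathbf{x}^0$, $\lambda>0$, sample sizes $N_k$ and $\theta>\lambda$: at outer iteration $k\ge0$ set $\mathbf{z}^k_0=\mathbf{x}^k$ and, for $j=0,\dots,N_k-1$, $\mathbf{z}^k_{j+1}=\mathbf{z}^k_j-\alpha_j u^k_j$ with $u^k_j=v^k_j+\tfrac1\lambda(\mathbf{z}^k_j-\mathbf{x}^k)$, where $v^k_j=v(\mathbf{z}^k_j,\omega_{k,j})$ is an oracle output at $\mathbf{z}^k_j$ with fresh independent sample $\omega_{k,j}$ (so the oracle properties hold conditionally on the past), and $\alpha_j=\theta/(j+1)$. Then $\mathbf{x}^{k+1}=\mathbf{z}^k_{N_k}$; this is an approximation of the resolvent $(I+\lambda T)^{-1}(\mathbf{x}^k)$. Iteration $k$ uses $N_k$ oracle calls.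
   Formalization: Part (b) is proved only for ρ > 1/(1+σλ)²; otherwise it fails: for T(x)=x, σ=λ=1, θ=3/2, exact oracle, ρ=1/5, the squared error is 4^{-k}|x⁰|² while the calls grow like 5^K, which is not O(1/ε). *)

theory Defs
  imports "HOL-Probability.Probability" "HOL-Library.Landau_Symbols"
begin

section \<open>Blocks of coordinates\<close>

text \<open>
  The players may have strategy spaces of different dimensions.  The product space
  $R^n$ is \<^typ>\<open>real ^ 'n\<close>, and \<open>own j\<close> is the player to whom coordinate \<open>j\<close> belongs.
  The space of player \<open>i\<close>, whose dimension is the number of \<open>j\<close> with \<open>own j = i\<close>, is
  identified with the subspace of vectors that vanish outside the coordinates of \<open>i\<close>.
\<close>

definition block_space :: "('n::finite \<Rightarrow> 'p) \<Rightarrow> 'p \<Rightarrow> (real ^ 'n) set" where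
  "block_space own i = {u. \<forall>j. own j \<noteq> i \<longrightarrow> u $ j = 0}"

definition block :: "('n::finite \<Rightarrow> 'p) \<Rightarrow> 'p \<Rightarrow> real ^ 'n \<Rightarrow> real ^ 'n" where
  "block own i x = (\<chi> j. if own j = i then x $ j else 0)"

definition replace_block ::
    "('n::finite \<Rightarrow> 'p) \<Rightarrow> 'p \<Rightarrow> real ^ 'n \<Rightarrow> real ^ 'n \<Rightarrow> real ^ 'n" where
  "replace_block own i x u = (\<chi> j. if own j = i then u $ j else x $ j)"


section \<open>Variational inequalities and set-valued operators\<close>

definition vi_solutions :: "'a::real_inner set \<Rightarrow> ('a \<Rightarrow> 'a) \<Rightarrow> 'a set" where
  "vi_solutions K H = {y \<in> K. \<forall>z\<in>K. H y \<bullet> (z - y) \<ge> 0}"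

definition strongly_monotone_map_on :: "'a::real_inner set \<Rightarrow> ('a \<Rightarrow> 'a) \<Rightarrow> bool" where
  "strongly_monotone_map_on K H \<longleftrightarrow>
     (\<exists>\<mu>>0. \<forall>y\<in>K. \<forall>z\<in>K. (H y - H z) \<bullet> (y - z) \<ge> \<mu> * (norm (y - z))\<^sup>2)"

definition monotone_op :: "('a::real_inner \<Rightarrow> 'a set) \<Rightarrow> bool" where
  "monotone_op T \<longleftrightarrow> (\<forall>x y. \<forall>u\<in>T x. \<forall>v\<in>T y. (u - v) \<bullet> (x - y) \<ge> 0)"

definition maximal_monotone :: "('a::real_inner \<Rightarrow> 'a set) \<Rightarrow> bool" where
  "maximal_monotone T \<longleftrightarrow>
     monotone_op T \<and> (\<forall>S. monotone_op S \<longrightarrow> (\<forall>x. T x \<subseteq> S x) \<longrightarrow> S = T)"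

definition strongly_monotone_op :: "real \<Rightarrow> ('a::real_inner \<Rightarrow> 'a set) \<Rightarrow> bool" where
  "strongly_monotone_op \<sigma> T \<longleftrightarrow>
     (\<forall>x y. \<forall>u\<in>T x. \<forall>v\<in>T y. (u - v) \<bullet> (x - y) \<ge> \<sigma> * (norm (x - y))\<^sup>2)"

text \<open>
  In the next two definitions \<open>V\<close> is the ambient subspace.  The function \<open>h\<close> is regarded as a
  convex function on \<open>S\<close>, so that subgradients are tested against points of \<open>S\<close> only.
\<close>

definition subdifferential_on ::
    "'a::real_inner set \<Rightarrow> 'a set \<Rightarrow> ('a \<Rightarrow> real) \<Rightarrow> 'a \<Rightarrow> 'a set" where
  "subdifferential_on V S h x = {g \<in> V. \<forall>u\<in>S. h u \<ge> h x + g \<bullet> (u - x)}"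

definition normal_cone :: "'a::real_inner set \<Rightarrow> 'a set \<Rightarrow> 'a \<Rightarrow> 'a set" where
  "normal_cone V S x = (if x \<in> S then {g \<in> V. \<forall>u\<in>S. g \<bullet> (u - x) \<le> 0} else {})"

definition aumann_expectation ::
    "'w measure \<Rightarrow> ('w \<Rightarrow> 'a::euclidean_space set) \<Rightarrow> 'a set" where
  "aumann_expectation P A =
     {integral\<^sup>L P g |g. integrable P g \<and> (AE w in P. g w \<in> A w)}"


section \<open>The hierarchical game\<close>

text \<open>
  \<open>cost G i x y w\<close> is the cost $f_i(x^i, x^{-i}, y, w)$, where \<open>x\<close> is the full strategy
  vector, and \<open>vi_map G i y x w\<close> is $F_i(y, x, w)$.
\<close>

record ('p, 'n::finite, 'm::finite, 'w) hier_game =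
  x_owner :: "'n \<Rightarrow> 'p"
  y_owner :: "'m \<Rightarrow> 'p"
  sample_space :: "'w measure"
  strategy :: "'p \<Rightarrow> (real ^ 'n) set"
  lower_set :: "'p \<Rightarrow> (real ^ 'm) set"
  vi_map :: "'p \<Rightarrow> real ^ 'm \<Rightarrow> real ^ 'n \<Rightarrow> 'w \<Rightarrow> real ^ 'm"
  cost :: "'p \<Rightarrow> real ^ 'n \<Rightarrow> real ^ 'm \<Rightarrow> 'w \<Rightarrow> real"

definition strategies :: "('p, 'n::finite, 'm::finite, 'w) hier_game \<Rightarrow> (real ^ 'n) set" where
  "strategies G = {x. \<forall>i. block (x_owner G) i x \<in> strategy G i}"

definition response ::
    "('p, 'n::finite, 'm::finite, 'w) hier_game \<Rightarrow> 'p \<Rightarrow> real ^ 'n \<Rightarrow> 'w \<Rightarrow> real ^ 'm" where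
  "response G i x w = (THE y. y \<in> vi_solutions (lower_set G i) (\<lambda>y. vi_map G i y x w))"

definition implicit_cost ::
    "('p, 'n::finite, 'm::finite, 'w) hier_game \<Rightarrow> 'p \<Rightarrow> real ^ 'n \<Rightarrow> 'w \<Rightarrow> real" where
  "implicit_cost G i x w = cost G i x (response G i x w) w"

text \<open>The implicit cost as a function of the own strategy \<open>u\<close>, the rivals playing as in \<open>x\<close>.\<close>

definition own_cost ::
    "('p, 'n::finite, 'm::finite, 'w) hier_game \<Rightarrow> 'p \<Rightarrow> real ^ 'n \<Rightarrow> 'w \<Rightarrow> real ^ 'n \<Rightarrow> real" where
  "own_cost G i x w u = implicit_cost G i (replace_block (x_owner G) i x u) w"

definition nash_equilibrium ::
    "('p, 'n::finite, 'm::finite, 'w) hier_game \<Rightarrow> real ^ 'n \<Rightarrow> bool" where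
  "nash_equilibrium G x \<longleftrightarrow> x \<in> strategies G \<and>
     (\<forall>i. \<forall>u\<in>strategy G i.
        integral\<^sup>L (sample_space G) (implicit_cost G i x)
          \<le> integral\<^sup>L (sample_space G) (\<lambda>w. own_cost G i x w u))"

definition game_Phi ::
    "('p, 'n::finite, 'm::finite, 'w) hier_game \<Rightarrow> real ^ 'n \<Rightarrow> 'w \<Rightarrow> (real ^ 'n) set" where
  "game_Phi G x w =
     {v. \<forall>i. \<exists>a \<in> subdifferential_on (block_space (x_owner G) i) (strategy G i)
                    (own_cost G i x w) (block (x_owner G) i x).
             \<exists>b \<in> normal_cone (block_space (x_owner G) i) (strategy G i)
                    (block (x_owner G) i x).
               block (x_owner G) i v = a + b}"

definition game_map ::
    "('p, 'n::finite, 'm::finite, 'w) hier_game \<Rightarrow> real ^ 'n \<Rightarrow> (real ^ 'n) set" where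
  "game_map G x = aumann_expectation (sample_space G) (game_Phi G x)"

locale hierarchical_game =
  fixes G :: "('p::finite, 'n::finite, 'm::finite, 'w) hier_game"
  assumes prob_sample: "prob_space (sample_space G)"
    and strategy_sub: "\<And>i. strategy G i \<subseteq> block_space (x_owner G) i"
    and strategy_closed: "\<And>i. closed (strategy G i)"
    and strategy_convex: "\<And>i. convex (strategy G i)"
    and lower_sub: "\<And>i. lower_set G i \<subseteq> block_space (y_owner G) i"
    and lower_closed: "\<And>i. closed (lower_set G i)"
    and lower_convex: "\<And>i. convex (lower_set G i)"
    and vi_map_in: "\<And>i x y w. x \<in> strategies G \<Longrightarrow> y \<in> lower_set G i \<Longrightarrow>
          w \<in> space (sample_space G) \<Longrightarrow> vi_map G i y x w \<in> block_space (y_owner G) i"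
    and vi_map_strongly_monotone: "\<And>i x w. x \<in> strategies G \<Longrightarrow>
          w \<in> space (sample_space G) \<Longrightarrow>
          strongly_monotone_map_on (lower_set G i) (\<lambda>y. vi_map G i y x w)"
    and response_unique: "\<And>i x w. x \<in> strategies G \<Longrightarrow> w \<in> space (sample_space G) \<Longrightarrow>
          \<exists>!y. y \<in> vi_solutions (lower_set G i) (\<lambda>y. vi_map G i y x w)"
    and own_cost_convex: "\<And>i x w. x \<in> strategies G \<Longrightarrow> w \<in> space (sample_space G) \<Longrightarrow>
          convex_on (strategy G i) (own_cost G i x w)"
    and cost_integrable: "\<And>i x. x \<in> strategies G \<Longrightarrow>
          integrable (sample_space G) (implicit_cost G i x)"
    and game_map_maximal_monotone: "maximal_monotone (game_map G)"
    and nash_exists: "\<exists>x. nash_equilibrium G x"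
    and zero_exists: "\<exists>x. 0 \<in> game_map G x"


section \<open>Oracle and scheme\<close>

text \<open>
  \<open>D\<close> is the set of points at which the oracle can be called; \<open>D = UNIV\<close> is an oracle that
  answers at every point.  Since \<^term>\<open>game_Phi G x w\<close> is empty unless \<open>x\<close> lies in
  \<^term>\<open>strategies G\<close>, such an oracle exists only for games without constraints, while a
  general \<open>D\<close> also admits constrained ones.
\<close>

definition stochastic_oracle ::
    "('p, 'n::finite, 'm::finite, 'w) hier_game \<Rightarrow> (real ^ 'n) set \<Rightarrow> real \<Rightarrow> real \<Rightarrow>
     (real ^ 'n \<Rightarrow> 'w \<Rightarrow> real ^ 'n) \<Rightarrow> bool" where
  "stochastic_oracle G D M1 M2 v \<longleftrightarrow>
     (\<lambda>(x, w). v x w) \<in> borel_measurable (borel \<Otimes>\<^sub>M sample_space G) \<and>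
     (\<forall>x\<in>D.
        (AE w in sample_space G. v x w \<in> game_Phi G x w) \<and>
        integrable (sample_space G) (v x) \<and>
        integral\<^sup>L (sample_space G) (v x) \<in> game_map G x \<and>
        integrable (sample_space G) (\<lambda>w. (norm (v x w))\<^sup>2) \<and>
        integral\<^sup>L (sample_space G) (\<lambda>w. (norm (v x w))\<^sup>2) \<le> M1\<^sup>2 * (norm x)\<^sup>2 + M2\<^sup>2)"

text \<open>
  The independent samples \<open>\<omega> k j\<close>, for \<open>j < N k\<close>, live on a common probability space \<open>\<Omega>\<close>
  and have the distribution \<open>P\<close>.
\<close>

definition fresh_samples ::
    "'s measure \<Rightarrow> 'w measure \<Rightarrow> (nat \<Rightarrow> nat) \<Rightarrow> (nat \<Rightarrow> nat \<Rightarrow> 's \<Rightarrow> 'w) \<Rightarrow> bool" where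
  "fresh_samples \<Omega> P N \<omega> \<longleftrightarrow>
     prob_space \<Omega> \<and>
     prob_space.indep_vars \<Omega> (\<lambda>_. P) (\<lambda>(k, j). \<omega> k j) (SIGMA k:UNIV. {..<N k}) \<and>
     (\<forall>k. \<forall>j<N k. distr \<Omega> P (\<omega> k j) = P)"

text \<open>\<open>ws\<close> is the realisation of the samples: of one inner loop, respectively of all of them.\<close>

primrec vrspp_inner ::
    "('a::real_vector \<Rightarrow> 'w \<Rightarrow> 'a) \<Rightarrow> real \<Rightarrow> real \<Rightarrow> 'a \<Rightarrow> (nat \<Rightarrow> 'w) \<Rightarrow> nat \<Rightarrow> 'a" where
  "vrspp_inner v lam \<theta> x ws 0 = x"
| "vrspp_inner v lam \<theta> x ws (Suc j) =
     (let z = vrspp_inner v lam \<theta> x ws j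
      in z - (\<theta> / real (j + 1)) *\<^sub>R (v z (ws j) + (1 / lam) *\<^sub>R (z - x)))"

primrec vrspp ::
    "('a::real_vector \<Rightarrow> 'w \<Rightarrow> 'a) \<Rightarrow> real \<Rightarrow> real \<Rightarrow> (nat \<Rightarrow> nat) \<Rightarrow> 'a \<Rightarrow>
     (nat \<Rightarrow> nat \<Rightarrow> 'w) \<Rightarrow> nat \<Rightarrow> 'a" where
  "vrspp v lam \<theta> N x0 ws 0 = x0"
| "vrspp v lam \<theta> N x0 ws (Suc k) =
     vrspp_inner v lam \<theta> (vrspp v lam \<theta> N x0 ws k) (ws k) (N k)"

text \<open>
  Number of oracle calls made when the error first drops to \<open>\<epsilon>\<close> after at least one outer
  iteration; meaningful only if the error does drop to \<open>\<epsilon>\<close>.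
\<close>

definition oracle_complexity :: "(nat \<Rightarrow> real) \<Rightarrow> (nat \<Rightarrow> nat) \<Rightarrow> real \<Rightarrow> nat" where
  "oracle_complexity err N \<epsilon> = (\<Sum>k\<le>(LEAST K. err (K + 1) \<le> \<epsilon>). N k)"

end

theory Submission
  imports Defs
begin

text \<open>
  The inner iterates are compared with the solution $x^*$ directly, not with the resolvent of
  $T$ at $x^k$, so that Minty's theorem is not needed.  Let $e_j$ be the mean squared distance
  of the $j$-th inner iterate to $x^*$, let $R = e_0$, $c = (1 + \sigma\lambda)/\lambda$ and
  $\beta = (1 + \sigma\lambda)^{-2}$.  Strong monotonicity at $x^*$, where $0 \in T(x^*)$, and
  the arithmetic-geometric mean inequality give
  $e_{j+1} \le (1 - \alpha_j c) e_j + \alpha_j c \beta R + \alpha_j^2 (A e_j + B R + C)$.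
  Since $\theta c > 1$, the excess $e_j - \beta R$ is of order $(R + 1)/j$, so each outer
  iteration contracts by $\beta < q$ up to a relative and an absolute error of order $\rho^k$.
\<close>

section \<open>Deterministic recursions and the count of oracle calls\<close>

text \<open>The guess \<open>w j \<le> L * X / j\<close> reproduces itself from \<open>j\<close> to
  \<open>j + 1\<close> as soon as \<open>A / (j + 1) + 1 / L \<le> p - 1\<close>, which is where
  \<open>p > 1\<close> enters; the finitely many earlier indices are absorbed into \<open>L\<close>
  by a crude exponential bound. \<open>L\<close> is chosen before \<open>w\<close>, \<open>X\<close>
  and \<open>m\<close>, so that one constant serves inner loops of every length and every starting
  error.\<close>

lemma stochastic_approximation_rate:
  fixes p A :: real
  assumes p: "p > 1" and A: "A \<ge> 0"
  obtains L where "L > 0"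
    "\<And>w X m. \<lbrakk>X \<ge> 0; w 0 \<le> X; m \<ge> 1;
        \<And>j. j < m \<Longrightarrow> w (Suc j) \<le> (1 - p / (j + 1) + A / (j + 1)\<^sup>2) * w j + X / (real j + 1)\<^sup>2;
        \<And>j. j < m \<Longrightarrow> 1 - p / (j + 1) + A / (j + 1)\<^sup>2 \<ge> 0\<rbrakk> \<Longrightarrow> w m \<le> L * X / real m"
proof -
  \<comment> \<open>From \<open>j0\<close> on, the second-order term \<open>A / (j + 1)\<close> uses
    at most half of the margin \<open>p - 1\<close>.\<close>
  obtain j0 :: nat where j0: "real j0 > 2 * A / (p - 1)"
    using reals_Archimedean2 by blast
  \<comment> \<open>The first entry makes \<open>1 / L\<close> fit into the other half of
    \<open>p - 1\<close>; the second covers the indices up to \<open>j0\<close>.\<close>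
  define L where "L = max (2 / (p - 1)) (real j0 * (2 + A) ^ j0)"
  have Lpos: "L > 0" using p unfolding L_def by (simp add: less_max_iff_disj)
  have invL: "1 / L \<le> (p - 1) / 2"
  proof -
    have "2 / (p - 1) \<le> L" by (simp add: L_def)
    then have "2 \<le> L * (p - 1)" using p by (simp add: field_simps)
    then show ?thesis using Lpos by (simp add: field_simps)
  qed
  show ?thesis
  proof (rule that[OF Lpos])
    fix w :: "nat \<Rightarrow> real" and X :: real and m :: nat
    assume X: "X \<ge> 0" and w0: "w 0 \<le> X" and m: "m \<ge> 1"
      and rec: "\<And>j. j < m \<Longrightarrow>
        w (Suc j) \<le> (1 - p / (j + 1) + A / (j + 1)\<^sup>2) * w j + X / (real j + 1)\<^sup>2"
      and nonneg: "\<And>j. j < m \<Longrightarrow> 1 - p / (j + 1) + A / (j + 1)\<^sup>2 \<ge> 0"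
    \<comment> \<open>Each step multiplies by at most \<open>1 + A\<close> and adds at most
      \<open>X\<close>, hence the base \<open>2 + A\<close>.\<close>
    have crude: "w j \<le> (2 + A) ^ j * X" if "j \<le> m" for j
      using that
    proof (induction j)
      case 0
      then show ?case using w0 by simp
    next
      case (Suc j)
      let ?g = "1 - p / (j + 1) + A / (j + 1)\<^sup>2"
      have sq: "(real j + 1)\<^sup>2 \<ge> 1" by (simp add: one_le_power)
      have g: "0 \<le> ?g" using nonneg[of j] Suc by simp
      have "A / (j + 1)\<^sup>2 \<le> A / 1" using A sq by (intro divide_left_mono) auto
      moreover have "p / (j + 1) \<ge> 0" using p by simp
      ultimately have g1: "?g \<le> 1 + A" by linarith
      have "w (Suc j) \<le> ?g * w j + X / (real j + 1)\<^sup>2" using rec[of j] Suc by simp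
      also have "\<dots> \<le> ?g * ((2 + A) ^ j * X) + X / 1"
        using Suc g X sq by (intro add_mono mult_left_mono divide_left_mono) auto
      also have "\<dots> \<le> (1 + A) * ((2 + A) ^ j * X) + (2 + A) ^ j * X"
      proof (rule add_mono)
        show "?g * ((2 + A) ^ j * X) \<le> (1 + A) * ((2 + A) ^ j * X)"
          using g1 X A by (intro mult_right_mono) auto
        have "1 * X \<le> (2 + A) ^ j * X"
          using A X by (intro mult_right_mono one_le_power) auto
        then show "X / 1 \<le> (2 + A) ^ j * X" by simp
      qed
      also have "\<dots> = (2 + A) ^ Suc j * X" by (simp add: algebra_simps)
      finally show ?case .
    qed
    have small: "w j \<le> L * X / real j" if j: "1 \<le> j" "j \<le> m" "j \<le> j0" for j
    proof -
      have "real j * (2 + A) ^ j \<le> real j0 * (2 + A) ^ j0"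
        using j A by (intro mult_mono power_increasing) auto
      also have "\<dots> \<le> L" by (simp add: L_def)
      finally have "real j * (2 + A) ^ j * X \<le> L * X" using X by (rule mult_right_mono)
      then have "(2 + A) ^ j * X \<le> L * X / real j" using j by (simp add: field_simps)
      then show ?thesis using crude[of j] j by linarith
    qed
    have "w j \<le> L * X / real j" if "1 \<le> j" "j \<le> m" for j
      using that
    proof (induction j)
      case 0
      then show ?case by simp
    next
      case (Suc j)
      show ?case
      proof (cases "Suc j \<le> j0 \<or> j = 0")
        case True
        show ?thesis
        proof (cases "Suc j \<le> j0")
          case True
          then show ?thesis using small[of "Suc j"] Suc by simp
        next
          case False
          \<comment> \<open>At \<open>j = 0\<close> the induction hypothesis is empty. The case
            cannot arise, since \<open>j0\<close> exceeds a nonnegative number and so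
            \<open>Suc 0 \<le> j0\<close>.\<close>
          then have "j0 = 0" "j = 0" using True by auto
          with j0 p A have False by (simp add: divide_less_0_iff)
          then show ?thesis ..
        qed
      next
        case False
        then have j: "j \<ge> 1" "j \<ge> j0" by auto
        let ?g = "1 - p / (j + 1) + A / (j + 1)\<^sup>2"
        let ?t = "real j + 1"
        have t: "?t > 0" "real j > 0" using j by auto
        have IH: "w j \<le> L * X / real j" using Suc j by simp
        have "A \<le> (p - 1) / 2 * ?t"
        proof -
          have "2 * A / (p - 1) \<le> ?t" using j0 j by linarith
          then show ?thesis using p by (simp add: field_simps)
        qed
        then have "A / ?t \<le> (p - 1) / 2" using t by (simp only: pos_divide_le_eq)
        then have key: "A / ?t + 1 / L \<le> p - 1" using invL by argo
        \<comment> \<open>With \<open>t = j + 1\<close>, taking out the factor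
          \<open>L * X / (j * t)\<close> reduces the step to
          \<open>?g * t + (j / t) / L \<le> j\<close>, which follows from
          \<open>t - p + A / t + 1 / L \<le> t - 1\<close>.\<close>
        have scaled: "g * (L * X / i) + X / t\<^sup>2 = (g * t + (i / t) / L) * (L * X / (i * t))"
          if "i > 0" "t > 0" for g i t :: real
          using that Lpos by (simp add: field_simps power2_eq_square)
        have "?g * (L * X / real j) + X / ?t\<^sup>2
            = (?g * ?t + (real j / ?t) / L) * (L * X / (real j * ?t))"
          by (rule scaled) (use t in auto)
        also have "\<dots> \<le> real j * (L * X / (real j * ?t))"
        proof (rule mult_right_mono)
          have "(1 - p / t + A / t\<^sup>2) * t = t - p + A / t" if "t > 0" for t
            using that by (simp add: field_simps power2_eq_square)
          from this[of ?t] have "?g * ?t = ?t - p + A / ?t" using t by (simp add: add.commute)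
          moreover have "(real j / ?t) / L \<le> 1 / L"
            using t Lpos by (intro divide_right_mono) auto
          ultimately show "?g * ?t + (real j / ?t) / L \<le> real j" using key by linarith
          show "0 \<le> L * X / (real j * ?t)" using X Lpos by simp
        qed
        also have "\<dots> = L * X / ?t" using t by simp
        finally have "?g * (L * X / real j) + X / ?t\<^sup>2 \<le> L * X / ?t" .
        moreover have "?g * w j \<le> ?g * (L * X / real j)"
          using IH nonneg[of j] Suc by (intro mult_left_mono) auto
        moreover have "w (Suc j) \<le> ?g * w j + X / ?t\<^sup>2" using rec[of j] Suc by simp
        ultimately show ?thesis by (simp add: add.commute)
      qed
    qed
    then show "w m \<le> L * X / real m" using m by simp
  qed
qed

lemma perturbed_linear_rate:
  fixes e :: "nat \<Rightarrow> real" and \<beta> \<rho> r K1 K2 :: real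
  assumes e: "\<And>k. e k \<ge> 0"
    and rec: "\<And>k. e (Suc k) \<le> (\<beta> + K1 * \<rho> ^ k) * e k + K2 * \<rho> ^ k"
    and \<rho>: "0 < \<rho>" "\<rho> < 1" "\<rho> \<le> r" and \<beta>: "0 \<le> \<beta>" "\<beta> < r" and K2: "K2 \<ge> 0"
  shows "\<exists>C>0. \<forall>k. e k \<le> C * r ^ k"
proof -
  have r: "r > 0" using \<rho> by linarith
  have "(\<lambda>k. K1 * \<rho> ^ k) \<longlonglongrightarrow> K1 * 0"
    using \<rho> by (intro tendsto_intros LIMSEQ_power_zero) auto
  then have "\<forall>\<^sub>F k in sequentially. K1 * \<rho> ^ k < (r - \<beta>) / 2"
    using \<beta> by (intro order_tendstoD) auto
  then obtain k0 where k0: "\<And>k. k \<ge> k0 \<Longrightarrow> K1 * \<rho> ^ k < (r - \<beta>) / 2"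
    unfolding eventually_sequentially by blast
  \<comment> \<open>The sum dominates \<open>e k / r ^ k\<close> for all \<open>k \<le> k0\<close>,
    the last term gives \<open>K2 \<le> C * ((r - \<beta>) / 2)\<close>, and the 1 makes
    \<open>C\<close> positive.\<close>
  define C where "C = 1 + (\<Sum>k\<le>k0. e k / r ^ k) + 2 * K2 / (r - \<beta>)"
  have s: "(\<Sum>k\<le>k0. e k / r ^ k) \<ge> 0" using e r by (intro sum_nonneg) auto
  have K: "2 * K2 / (r - \<beta>) \<ge> 0" using K2 \<beta> by simp
  have C: "C > 0" using s K unfolding C_def by linarith
  have K2C: "K2 \<le> C * ((r - \<beta>) / 2)"
  proof -
    have "2 * K2 / (r - \<beta>) \<le> C" using s by (simp add: C_def)
    then show ?thesis using \<beta> by (simp add: field_simps)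
  qed
  have "e k \<le> C * r ^ k" for k
  proof (induction k)
    case 0
    have "e 0 / r ^ 0 \<le> (\<Sum>k\<le>k0. e k / r ^ k)"
      using e r by (intro member_le_sum) auto
    then show ?case using K by (simp add: C_def)
  next
    case (Suc k)
    show ?case
    proof (cases "Suc k \<le> k0")
      case True
      have "e (Suc k) / r ^ Suc k \<le> (\<Sum>k\<le>k0. e k / r ^ k)"
        using e r True by (intro member_le_sum) auto
      then have "e (Suc k) / r ^ Suc k \<le> C" using K by (simp add: C_def)
      then show ?thesis using r by (simp add: field_simps)
    next
      case False
      then have "K1 * \<rho> ^ k \<le> (r - \<beta>) / 2" using k0[of k] by simp
      then have "(\<beta> + K1 * \<rho> ^ k) * e k \<le> (r + \<beta>) / 2 * e k"
        using e[of k] by (intro mult_right_mono) (auto simp: field_simps)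
      moreover have "K2 * \<rho> ^ k \<le> C * ((r - \<beta>) / 2) * r ^ k"
        using K2C K2 \<rho> by (intro mult_mono power_mono) auto
      moreover have "(r + \<beta>) / 2 * e k \<le> (r + \<beta>) / 2 * (C * r ^ k)"
        using Suc r \<beta> by (intro mult_left_mono) auto
      moreover have "(r + \<beta>) / 2 * (C * r ^ k) + C * ((r - \<beta>) / 2) * r ^ k = C * r ^ Suc k"
        by (simp add: field_simps)
      ultimately show ?thesis using rec[of k] by linarith
    qed
  qed
  with C show ?thesis by blast
qed

text \<open>If the least index \<open>K\<close> is positive, then \<open>K - 1\<close> fails, so
  \<open>\<epsilon> < e K \<le> C * \<rho> ^ K\<close> and \<open>(1 / \<rho>) ^ K\<close> is below
  \<open>C / \<epsilon>\<close>; a growing geometric sum is of the order of its last term. The first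
  conclusion ensures that the \<open>LEAST\<close> in \<open>oracle_complexity\<close> refers to an
  index that exists.\<close>

lemma oracle_complexity_bigo:
  fixes e :: "nat \<Rightarrow> real" and C \<rho> :: real
  assumes \<rho>: "0 < \<rho>" "\<rho> < 1" and C: "C > 0" "\<And>k. e k \<le> C * \<rho> ^ k"
    and N: "\<And>k. real (N k) \<le> (1 / \<rho>) ^ Suc k"
  shows "\<forall>\<epsilon>>0. \<exists>K. e (K + 1) \<le> \<epsilon>"
    and "(\<lambda>\<epsilon>. real (oracle_complexity e N \<epsilon>)) \<in> O[at_right 0](\<lambda>\<epsilon>. 1 / \<epsilon>)"
proof -
  show ex: "\<forall>\<epsilon>>0. \<exists>K. e (K + 1) \<le> \<epsilon>"
  proof (intro allI impI)
    fix \<epsilon> :: real assume "\<epsilon> > 0"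
    then obtain n where n: "\<rho> ^ n < \<epsilon> / C"
      using real_arch_pow_inv[of "\<epsilon> / C" \<rho>] \<rho> C by auto
    have "e (n + 1) \<le> C * \<rho> ^ (n + 1)" by (rule C)
    also have "\<dots> \<le> C * \<rho> ^ n" using C \<rho> by (intro mult_left_mono power_decreasing) auto
    also have "\<dots> \<le> \<epsilon>" using n C by (simp add: field_simps)
    finally show "\<exists>K. e (K + 1) \<le> \<epsilon>" by blast
  qed
  have geo: "(\<Sum>k\<le>K. real (N k)) \<le> (1 / \<rho>) ^ K / (\<rho> * (1 - \<rho>))" for K
  proof -
    have "(\<Sum>k\<le>K. real (N k)) \<le> (\<Sum>k\<le>K. (1 / \<rho>) ^ Suc k)" by (intro sum_mono N)
    also have "\<dots> \<le> (1 / \<rho>) ^ K / (\<rho> * (1 - \<rho>))"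
    proof (induction K)
      case 0
      show ?case using \<rho> by (simp add: field_simps)
    next
      case (Suc K)
      have "(1 / \<rho>) ^ K / (\<rho> * (1 - \<rho>)) + (1 / \<rho>) ^ Suc (Suc K)
          = (1 / \<rho>) ^ Suc K / (\<rho> * (1 - \<rho>))"
        using \<rho> by (simp add: divide_simps)
      then show ?case using Suc by simp
    qed
    finally show ?thesis .
  qed
  show "(\<lambda>\<epsilon>. real (oracle_complexity e N \<epsilon>)) \<in> O[at_right 0](\<lambda>\<epsilon>. 1 / \<epsilon>)"
  proof (rule bigoI)
    show "\<forall>\<^sub>F \<epsilon> in at_right 0. norm (real (oracle_complexity e N \<epsilon>))
        \<le> (max 1 C / (\<rho> * (1 - \<rho>))) * norm (1 / \<epsilon>)"
      unfolding eventually_at_right_field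
    proof (intro exI[of _ 1] conjI allI impI)
      fix \<epsilon> :: real assume \<epsilon>: "0 < \<epsilon>" "\<epsilon> < 1"
      define K where "K = (LEAST K. e (K + 1) \<le> \<epsilon>)"
      \<comment> \<open>For \<open>K = 0\<close> minimality says nothing; the claim is then
        \<open>1 \<le> max 1 C / \<epsilon>\<close>, true because \<open>\<epsilon> < 1\<close>.
        Hence the maximum.\<close>
      have bound: "(1 / \<rho>) ^ K \<le> max 1 C / \<epsilon>"
      proof (cases K)
        case 0
        then show ?thesis using \<epsilon> by (simp add: field_simps)
      next
        case (Suc K')
        then have "\<not> e (K' + 1) \<le> \<epsilon>" 
          using not_less_Least[of K' "\<lambda>K. e (K + 1) \<le> \<epsilon>"] unfolding K_def by simp
        then have "\<epsilon> < C * \<rho> ^ K" using C(2)[of K] Suc by simp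
        then have "(1 / \<rho>) ^ K \<le> C / \<epsilon>" using \<rho> \<epsilon> by (simp add: field_simps power_divide)
        also have "\<dots> \<le> max 1 C / \<epsilon>" using \<epsilon> by (intro divide_right_mono) auto
        finally show ?thesis .
      qed
      have "real (oracle_complexity e N \<epsilon>) \<le> (1 / \<rho>) ^ K / (\<rho> * (1 - \<rho>))"
        using geo[of K] by (simp add: oracle_complexity_def K_def)
      also have "\<dots> \<le> (max 1 C / \<epsilon>) / (\<rho> * (1 - \<rho>))"
        using bound \<rho> by (intro divide_right_mono) auto
      finally show "norm (real (oracle_complexity e N \<epsilon>))
          \<le> (max 1 C / (\<rho> * (1 - \<rho>))) * norm (1 / \<epsilon>)"
        using \<epsilon> by (simp add: mult.commute)
    qed auto
  qed
qed

section \<open>Integrating out an independent sample\<close>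

text \<open>
  Independence appears below as a product form of the joint distribution, because
  \<^const>\<open>prob_space.indep_var\<close> requires both variables to have values in the same type.
\<close>

lemma (in prob_space)
  fixes g :: "'b \<Rightarrow> 'c \<Rightarrow> real" and X :: "'a \<Rightarrow> 'b" and Y :: "'a \<Rightarrow> 'c"
  assumes P: "prob_space P" and [measurable]: "X \<in> measurable M S" "Y \<in> measurable M P"
    and joint: "distr M (S \<Otimes>\<^sub>M P) (\<lambda>s. (X s, Y s)) = distr M S X \<Otimes>\<^sub>M P"
    and g: "(\<lambda>(x, y). g x y) \<in> borel_measurable (S \<Otimes>\<^sub>M P)"
  shows nn_integral_indep_pair:
      "(\<integral>\<^sup>+ s. ennreal (g (X s) (Y s)) \<partial>M) = (\<integral>\<^sup>+ s. (\<integral>\<^sup>+ y. ennreal (g (X s) y) \<partial>P) \<partial>M)"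
    and integral_indep_pair: "integrable M (\<lambda>s. g (X s) (Y s)) \<Longrightarrow>
      integrable M (\<lambda>s. \<integral>y. g (X s) y \<partial>P) \<and>
      (\<integral>s. g (X s) (Y s) \<partial>M) = (\<integral>s. (\<integral>y. g (X s) y \<partial>P) \<partial>M)"
proof -
  note [measurable] = g
  interpret DX: prob_space "distr M S X" by (rule prob_space_distr) simp
  interpret DY: prob_space P by (rule P)
  interpret pair: pair_prob_space "distr M S X" P ..
  have "(\<integral>\<^sup>+ s. ennreal (g (X s) (Y s)) \<partial>M)
      = (\<integral>\<^sup>+ p. ennreal (case p of (x, y) \<Rightarrow> g x y) \<partial>(distr M S X \<Otimes>\<^sub>M P))"
    unfolding joint[symmetric] by (subst nn_integral_distr) auto
  also have "\<dots> = (\<integral>\<^sup>+ x. (\<integral>\<^sup>+ y. ennreal (g x y) \<partial>P) \<partial>distr M S X)"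
    by (subst DY.nn_integral_fst[symmetric]) auto
  also have "\<dots> = (\<integral>\<^sup>+ s. (\<integral>\<^sup>+ y. ennreal (g (X s) y) \<partial>P) \<partial>M)"
    by (subst nn_integral_distr) auto
  finally show "(\<integral>\<^sup>+ s. ennreal (g (X s) (Y s)) \<partial>M) = (\<integral>\<^sup>+ s. (\<integral>\<^sup>+ y. ennreal (g (X s) y) \<partial>P) \<partial>M)" .
  assume int: "integrable M (\<lambda>s. g (X s) (Y s))"
  then have int': "integrable (distr M S X \<Otimes>\<^sub>M P) (\<lambda>(x, y). g x y)"
    unfolding joint[symmetric] by (subst integrable_distr_eq) auto
  have "integrable (distr M S X) (\<lambda>x. \<integral>y. g x y \<partial>P)"
    using pair.integrable_fst'[OF int'] by simp
  then have 1: "integrable M (\<lambda>s. \<integral>y. g (X s) y \<partial>P)"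
    by (subst (asm) integrable_distr_eq) auto
  have "(\<integral>s. g (X s) (Y s) \<partial>M) = (\<integral>p. (case p of (x, y) \<Rightarrow> g x y) \<partial>(distr M S X \<Otimes>\<^sub>M P))"
    unfolding joint[symmetric] by (subst integral_distr) auto
  also have "\<dots> = (\<integral>x. (\<integral>y. g x y \<partial>P) \<partial>distr M S X)"
    using pair.integral_fst'[OF int'] by simp
  also have "\<dots> = (\<integral>s. (\<integral>y. g (X s) y \<partial>P) \<partial>M)"
    by (subst integral_distr) auto
  finally show "integrable M (\<lambda>s. \<integral>y. g (X s) y \<partial>P) \<and>
      (\<integral>s. g (X s) (Y s) \<partial>M) = (\<integral>s. (\<integral>y. g (X s) y \<partial>P) \<partial>M)" using 1 by simp
qed

lemma norm_add_sq_le: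
  fixes a b :: "'a::real_inner"
  shows "(norm (a + b))\<^sup>2 \<le> 2 * (norm a)\<^sup>2 + 2 * (norm b)\<^sup>2"
  using zero_le_power2[of "norm (a - b)"]
  by (simp add: power2_norm_eq_inner inner_simps inner_commute)

lemma (in prob_space) integrable_norm_sq_add:
  fixes X Y :: "'a \<Rightarrow> 'b::euclidean_space"
  assumes [measurable]: "X \<in> borel_measurable M" "Y \<in> borel_measurable M"
    and "integrable M (\<lambda>s. (norm (X s))\<^sup>2)" "integrable M (\<lambda>s. (norm (Y s))\<^sup>2)"
  shows "integrable M (\<lambda>s. (norm (X s + Y s))\<^sup>2)"
proof (rule Bochner_Integration.integrable_bound)
  show "integrable M (\<lambda>s. 2 * (norm (X s))\<^sup>2 + 2 * (norm (Y s))\<^sup>2)" using assms by simp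
  show "AE s in M. norm ((norm (X s + Y s))\<^sup>2) \<le> norm (2 * (norm (X s))\<^sup>2 + 2 * (norm (Y s))\<^sup>2)"
    by (intro AE_I2) (use norm_add_sq_le in auto)
qed simp

lemma (in prob_space) integrable_inner:
  fixes a z :: "'a \<Rightarrow> 'b::euclidean_space"
  assumes [measurable]: "a \<in> borel_measurable M" "z \<in> borel_measurable M"
    and "integrable M (\<lambda>s. (norm (a s))\<^sup>2)" "integrable M (\<lambda>s. (norm (z s))\<^sup>2)"
  shows "integrable M (\<lambda>s. a s \<bullet> z s)"
proof (rule Bochner_Integration.integrable_bound)
  show "integrable M (\<lambda>s. (norm (a s))\<^sup>2 + (norm (z s))\<^sup>2)" using assms by simp
  show "AE s in M. norm (a s \<bullet> z s) \<le> norm ((norm (a s))\<^sup>2 + (norm (z s))\<^sup>2)"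
  proof (intro AE_I2)
    fix s
    have "\<bar>a s \<bullet> z s\<bar> \<le> norm (a s) * norm (z s)" by (rule Cauchy_Schwarz_ineq2)
    also have "\<dots> \<le> (norm (a s))\<^sup>2 + (norm (z s))\<^sup>2"
      using zero_le_power2[of "norm (a s) - norm (z s)"] zero_le_power2[of "norm (a s)"]
        zero_le_power2[of "norm (z s)"] by (simp only: power2_diff)
    finally show "norm (a s \<bullet> z s) \<le> norm ((norm (a s))\<^sup>2 + (norm (z s))\<^sup>2)" by simp
  qed
qed simp

text \<open>Because the joint law of \<open>z\<close> and \<open>Y\<close> is a product, the sample
  can be integrated out first with \<open>z\<close> frozen. Bounds known at each fixed point of
  \<open>D\<close> thus carry over to a random point that lies in \<open>D\<close> almost surely,
  without conditional expectations.\<close>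

lemma (in prob_space) random_oracle_call:
  fixes v :: "'b::euclidean_space \<Rightarrow> 'c \<Rightarrow> 'b" and z :: "'a \<Rightarrow> 'b" and Y :: "'a \<Rightarrow> 'c"
  assumes v: "(\<lambda>(x, w). v x w) \<in> borel_measurable (borel \<Otimes>\<^sub>M P)"
    and mean: "\<And>y. y \<in> D \<Longrightarrow> integrable P (v y) \<and>
        (\<integral>w. v y w \<partial>P) \<bullet> (y - a) \<ge> \<sigma> * (norm (y - a))\<^sup>2"
    and second: "\<And>y. y \<in> D \<Longrightarrow> integrable P (\<lambda>w. (norm (v y w))\<^sup>2) \<and>
        (\<integral>w. (norm (v y w))\<^sup>2 \<partial>P) \<le> M1\<^sup>2 * (norm y)\<^sup>2 + M2\<^sup>2"
    and P: "prob_space P" and z_meas: "z \<in> borel_measurable M" and Y: "Y \<in> measurable M P"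
    and joint: "distr M (borel \<Otimes>\<^sub>M P) (\<lambda>s. (z s, Y s)) = distr M borel z \<Otimes>\<^sub>M P"
    and D: "AE s in M. z s \<in> D"
    and z: "integrable M (\<lambda>s. (norm (z s))\<^sup>2)"
  shows "integrable M (\<lambda>s. (norm (v (z s) (Y s)))\<^sup>2)"
    and "(\<integral>s. (norm (v (z s) (Y s)))\<^sup>2 \<partial>M) \<le> M1\<^sup>2 * (\<integral>s. (norm (z s))\<^sup>2 \<partial>M) + M2\<^sup>2"
    and "integrable M (\<lambda>s. v (z s) (Y s) \<bullet> (z s - a))"
    and "(\<integral>s. v (z s) (Y s) \<bullet> (z s - a) \<partial>M) \<ge> \<sigma> * (\<integral>s. (norm (z s - a))\<^sup>2 \<partial>M)"
proof -
  note [measurable] = v z_meas Y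
  have vY[measurable]: "(\<lambda>s. v (z s) (Y s)) \<in> borel_measurable M"
    using measurable_compose[OF _ v, of "\<lambda>s. (z s, Y s)" M] by simp
  have g1: "(\<lambda>(x, w). (norm (v x w))\<^sup>2) \<in> borel_measurable (borel \<Otimes>\<^sub>M P)" by measurable
  have g2: "(\<lambda>(x, w). v x w \<bullet> (x - a)) \<in> borel_measurable (borel \<Otimes>\<^sub>M P)" by measurable
  let ?b = "M1\<^sup>2 * (\<integral>s. (norm (z s))\<^sup>2 \<partial>M) + M2\<^sup>2"
  have b: "?b = (\<integral>s. M1\<^sup>2 * (norm (z s))\<^sup>2 + M2\<^sup>2 \<partial>M)" using z by (simp add: prob_space)
  \<comment> \<open>Integrability at the random point is not known yet, so the nonnegative form of
    Fubini comes first; it yields the second moment bound and integrability together.\<close>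
  have "(\<integral>\<^sup>+ s. ennreal ((norm (v (z s) (Y s)))\<^sup>2) \<partial>M)
      = (\<integral>\<^sup>+ s. (\<integral>\<^sup>+ w. ennreal ((norm (v (z s) w))\<^sup>2) \<partial>P) \<partial>M)"
    by (rule nn_integral_indep_pair[OF P z_meas Y joint g1])
  also have "\<dots> \<le> (\<integral>\<^sup>+ s. ennreal (M1\<^sup>2 * (norm (z s))\<^sup>2 + M2\<^sup>2) \<partial>M)"
  proof (rule nn_integral_mono_AE)
    show "AE s in M. (\<integral>\<^sup>+ w. ennreal ((norm (v (z s) w))\<^sup>2) \<partial>P)
        \<le> ennreal (M1\<^sup>2 * (norm (z s))\<^sup>2 + M2\<^sup>2)"
      using D
    proof eventually_elim
      case (elim s)
      then show ?case
        using second[of "z s"]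
        by (subst nn_integral_eq_integral) (auto intro: ennreal_leI simp del: ennreal_plus)
    qed
  qed
  also have "\<dots> = ennreal ?b"
    unfolding b using z by (intro nn_integral_eq_integral) auto
  finally have le: "(\<integral>\<^sup>+ s. ennreal ((norm (v (z s) (Y s)))\<^sup>2) \<partial>M) \<le> ennreal ?b" .
  show int: "integrable M (\<lambda>s. (norm (v (z s) (Y s)))\<^sup>2)"
  proof (rule integrableI_bounded)
    show "(\<integral>\<^sup>+ s. ennreal (norm ((norm (v (z s) (Y s)))\<^sup>2)) \<partial>M) < \<infinity>"
      using le by (simp add: le_less_trans)
  qed simp
  have "ennreal (\<integral>s. (norm (v (z s) (Y s)))\<^sup>2 \<partial>M) \<le> ennreal ?b"
    using le nn_integral_eq_integral[OF int] by simp
  then show "(\<integral>s. (norm (v (z s) (Y s)))\<^sup>2 \<partial>M) \<le> ?b"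
    by (subst (asm) ennreal_le_iff) auto
  have za: "integrable M (\<lambda>s. (norm (z s - a))\<^sup>2)"
    using integrable_norm_sq_add[of z "\<lambda>_. - a"] z by simp
  \<comment> \<open>Square integrability of both factors makes the inner product integrable, so that
    the signed form of Fubini applies.\<close>
  show inner: "integrable M (\<lambda>s. v (z s) (Y s) \<bullet> (z s - a))"
    using int za by (intro integrable_inner) auto
  note I = integral_indep_pair[OF P z_meas Y joint g2 inner]
  have "\<sigma> * (\<integral>s. (norm (z s - a))\<^sup>2 \<partial>M) = (\<integral>s. \<sigma> * (norm (z s - a))\<^sup>2 \<partial>M)" by simp
  also have "\<dots> \<le> (\<integral>s. (\<integral>w. v (z s) w \<bullet> (z s - a) \<partial>P) \<partial>M)"
  proof (rule integral_mono_AE)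
    show "AE s in M. \<sigma> * (norm (z s - a))\<^sup>2 \<le> (\<integral>w. v (z s) w \<bullet> (z s - a) \<partial>P)"
      using D
    proof eventually_elim
      case (elim s)
      then show ?case using mean[of "z s"] by simp
    qed
  qed (use za I in auto)
  finally show "(\<integral>s. v (z s) (Y s) \<bullet> (z s - a) \<partial>M) \<ge> \<sigma> * (\<integral>s. (norm (z s - a))\<^sup>2 \<partial>M)"
    using I by simp
qed

section \<open>Measurability of the iterates and independence of the next sample\<close>

text \<open>Serves, with its analogue for the outer loop, to replace the samples by their
  restriction to the indices already read, the form in which independence over disjoint index sets
  is available.\<close>

lemma vrspp_inner_cong:
  "(\<And>i. i < j \<Longrightarrow> ws i = ws' i) \<Longrightarrow>
    vrspp_inner v lam \<theta> x ws j = vrspp_inner v lam \<theta> x ws' j"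
  by (induction j) auto

lemma vrspp_cong:
  "(\<And>l i. l < k \<Longrightarrow> i < N l \<Longrightarrow> ws l i = ws' l i) \<Longrightarrow>
    vrspp v lam \<theta> N x0 ws k = vrspp v lam \<theta> N x0 ws' k"
proof (induction k)
  case (Suc k)
  then show ?case using vrspp_inner_cong[of "N k" "ws k" "ws' k"] by simp
qed simp

lemma measurable_vrspp_inner:
  fixes v :: "'b::euclidean_space \<Rightarrow> 'c \<Rightarrow> 'b"
  assumes v: "(\<lambda>(x, w). v x w) \<in> borel_measurable (borel \<Otimes>\<^sub>M P)"
    and x[measurable]: "x \<in> borel_measurable M"
    and ws: "\<And>i. i < j \<Longrightarrow> (\<lambda>s. ws s i) \<in> measurable M P"
  shows "(\<lambda>s. vrspp_inner v lam \<theta> (x s) (ws s) j) \<in> borel_measurable M"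
  using ws
proof (induction j)
  case (Suc j)
  have [measurable]: "(\<lambda>s. vrspp_inner v lam \<theta> (x s) (ws s) j) \<in> borel_measurable M"
    "(\<lambda>s. ws s j) \<in> measurable M P"
    using Suc by auto
  have [measurable]: "(\<lambda>s. v (vrspp_inner v lam \<theta> (x s) (ws s) j) (ws s j)) \<in> borel_measurable M"
    using measurable_compose[OF _ v, of "\<lambda>s. (vrspp_inner v lam \<theta> (x s) (ws s) j, ws s j)" M]
    by simp
  show ?case by (simp add: Let_def)
qed simp

lemma measurable_vrspp:
  fixes v :: "'b::euclidean_space \<Rightarrow> 'c \<Rightarrow> 'b"
  assumes v: "(\<lambda>(x, w). v x w) \<in> borel_measurable (borel \<Otimes>\<^sub>M P)"
    and ws: "\<And>l i. l < k \<Longrightarrow> i < N l \<Longrightarrow> (\<lambda>s. ws s l i) \<in> measurable M P"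
  shows "(\<lambda>s. vrspp v lam \<theta> N x0 (ws s) k) \<in> borel_measurable M"
  using ws
proof (induction k)
  case (Suc k)
  then show ?case by (auto intro!: measurable_vrspp_inner[OF v])
qed simp

text \<open>The iterate is a measurable function of the samples of earlier loops and of the first
  \<open>j\<close> samples of loop \<open>k\<close>; the index \<open>(k, j)\<close> is not among
  them. Independence over disjoint index sets gives a product law for the two families, which is
  then pushed forward to the iterate and the sample.\<close>

lemma (in prob_space) distr_iterate_next_sample:
  fixes v :: "'b::euclidean_space \<Rightarrow> 'c \<Rightarrow> 'b" and x0 :: 'b and lam \<theta> :: real
    and \<omega> :: "nat \<Rightarrow> nat \<Rightarrow> 'a \<Rightarrow> 'c"
  assumes v: "(\<lambda>(x, w). v x w) \<in> borel_measurable (borel \<Otimes>\<^sub>M P)"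
    and ind: "indep_vars (\<lambda>_. P) (\<lambda>(k, j). \<omega> k j) (SIGMA k:UNIV. {..<N k})"
    and P: "prob_space P" and distr: "distr M P (\<omega> k j) = P" and j: "j < N k"
  defines "z \<equiv>
      (\<lambda>s. vrspp_inner v lam \<theta> (vrspp v lam \<theta> N x0 (\<lambda>k j. \<omega> k j s) k) (\<lambda>j. \<omega> k j s) j)"
  shows "distr M (borel \<Otimes>\<^sub>M P) (\<lambda>s. (z s, \<omega> k j s)) = distr M borel z \<Otimes>\<^sub>M P"
proof -
  interpret P: prob_space P by (rule P)
  \<comment> \<open>\<open>A\<close> lists the samples read before call \<open>(k, j)\<close>. The
    single new sample is also treated as a family, over \<open>B\<close>, so that both variables
    have the same type.\<close>
  define A where "A = (SIGMA l:{..<k}. {..<N l}) \<union> {k} \<times> {..<j}"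
  define B where "B = {(k, j)}"
  define \<phi> where "\<phi> f = vrspp_inner v lam \<theta>
      (vrspp v lam \<theta> N x0 (\<lambda>l i. f (l, i)) k) (\<lambda>i. f (k, i)) j" for f :: "nat \<times> nat \<Rightarrow> 'c"
  define \<psi> where "\<psi> f = f (k, j)" for f :: "nat \<times> nat \<Rightarrow> 'c"
  let ?X = "\<lambda>C s. \<lambda>i\<in>C. (case i of (k, j) \<Rightarrow> \<omega> k j) s"
  let ?A = "PiM A (\<lambda>_. P)" and ?B = "PiM B (\<lambda>_. P)"
  have ind2: "indep_var ?A (?X A) ?B (?X B)"
    using j by (intro indep_var_restrict[OF ind]) (auto simp: A_def B_def)
  note [measurable] = indep_var_rv1[OF ind2] indep_var_rv2[OF ind2]
  have [measurable]: "\<phi> \<in> measurable ?A borel"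
    unfolding \<phi>_def
    by (intro measurable_vrspp_inner[OF v] measurable_vrspp[OF v] measurable_component_singleton)
      (auto simp: A_def)
  have [measurable]: "\<psi> \<in> measurable ?B P"
    unfolding \<psi>_def by (intro measurable_component_singleton) (auto simp: B_def)
  \<comment> \<open>Outside \<open>A\<close> the restricted family is \<open>undefined\<close>, but
    those entries are never read.\<close>
  have z: "\<phi> (?X A s) = z s" for s
  proof -
    have "vrspp v lam \<theta> N x0 (\<lambda>l i. ?X A s (l, i)) k = vrspp v lam \<theta> N x0 (\<lambda>k j. \<omega> k j s) k"
      by (rule vrspp_cong) (auto simp: A_def)
    moreover have "vrspp_inner v lam \<theta> y (\<lambda>i. ?X A s (k, i)) j
        = vrspp_inner v lam \<theta> y (\<lambda>j. \<omega> k j s) j" for y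
      by (rule vrspp_inner_cong) (auto simp: A_def)
    ultimately show ?thesis by (simp only: \<phi>_def z_def)
  qed
  have w: "\<psi> (?X B s) = \<omega> k j s" for s by (simp add: \<psi>_def B_def)
  have "distr (distr M ?A (?X A)) borel \<phi> = distr M borel z"
    by (subst distr_distr) (auto simp: comp_def z)
  moreover have B: "distr (distr M ?B (?X B)) P \<psi> = P"
    using distr by (subst distr_distr) (auto simp: comp_def w)
  ultimately have "distr M borel z \<Otimes>\<^sub>M P
      = distr (distr M ?A (?X A)) borel \<phi> \<Otimes>\<^sub>M distr (distr M ?B (?X B)) P \<psi>"
    by simp
  also have "\<dots> = distr (distr M ?A (?X A) \<Otimes>\<^sub>M distr M ?B (?X B)) (borel \<Otimes>\<^sub>M P)
      (\<lambda>(f, g). (\<phi> f, \<psi> g))"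
    by (rule pair_measure_distr) (auto simp: B P.sigma_finite_measure_axioms)
  also have "distr M ?A (?X A) \<Otimes>\<^sub>M distr M ?B (?X B)
      = distr M (?A \<Otimes>\<^sub>M ?B) (\<lambda>s. (?X A s, ?X B s))"
    using ind2 unfolding indep_var_distribution_eq by blast
  also have "distr \<dots> (borel \<Otimes>\<^sub>M P) (\<lambda>(f, g). (\<phi> f, \<psi> g))
      = distr M (borel \<Otimes>\<^sub>M P) (\<lambda>s. (z s, \<omega> k j s))"
    by (subst distr_distr) (auto simp: comp_def z w)
  finally show ?thesis by simp
qed

section \<open>One regularized step and its accumulation over an inner loop\<close>

text \<open>Here \<open>a\<close> and \<open>b\<close> stand for the inner and the outer iterate
  minus the solution. The weight \<open>h = 1 + \<sigma> * l\<close> in the arithmetic-geometric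
  mean inequality is chosen so that, once strong monotonicity bounds \<open>V \<bullet> a\<close>,
  the first-order decrease in the squared norm of \<open>a\<close> is \<open>\<alpha>\<close> times
  \<open>2 * \<sigma> + 2 / l - h / l = h / l\<close>. The squared norm of \<open>b\<close> then has
  the coefficient \<open>\<alpha>\<close> times \<open>1 / (l * h)\<close>, which is
  \<open>h / l\<close> times the contraction factor \<open>1 / h\<^sup>2\<close>.\<close>

lemma regularized_step_norm_sq:
  fixes V a b :: "'b::real_inner"
  assumes l: "l > 0" and \<sigma>: "\<sigma> > 0" and \<alpha>: "\<alpha> \<ge> 0"
  shows "(norm (a - \<alpha> *\<^sub>R (V + (1 / l) *\<^sub>R (a - b))))\<^sup>2
    \<le> (norm a)\<^sup>2 - 2 * \<alpha> * (V \<bullet> a) - (2 * \<alpha> / l) * (norm a)\<^sup>2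
      + (\<alpha> / l) * ((1 + \<sigma> * l) * (norm a)\<^sup>2 + (norm b)\<^sup>2 / (1 + \<sigma> * l))
      + \<alpha>\<^sup>2 * (2 * (norm V)\<^sup>2 + (4 / l\<^sup>2) * ((norm a)\<^sup>2 + (norm b)\<^sup>2))"
proof -
  define h where "h = 1 + \<sigma> * l"
  have h: "h > 0" using l \<sigma> unfolding h_def by (simp add: add_pos_pos)
  have "0 \<le> (norm (h *\<^sub>R a - b))\<^sup>2 / h" using h by simp
  also have "\<dots> = h * (norm a)\<^sup>2 - 2 * (a \<bullet> b) + (norm b)\<^sup>2 / h"
    using h by (simp add: power2_norm_eq_inner inner_simps inner_commute field_simps)
  finally have amgm: "2 * (a \<bullet> b) \<le> h * (norm a)\<^sup>2 + (norm b)\<^sup>2 / h" by simp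
  have "(norm (a - b))\<^sup>2 \<le> 2 * ((norm a)\<^sup>2 + (norm b)\<^sup>2)" using norm_add_sq_le[of a "- b"] by simp
  then have "2 * (norm (a - b))\<^sup>2 / l\<^sup>2 \<le> 4 * ((norm a)\<^sup>2 + (norm b)\<^sup>2) / l\<^sup>2"
    by (intro divide_right_mono) auto
  then have "(norm (V + (1 / l) *\<^sub>R (a - b)))\<^sup>2 \<le> 2 * (norm V)\<^sup>2 + (4 / l\<^sup>2) * ((norm a)\<^sup>2 + (norm b)\<^sup>2)"
    using norm_add_sq_le[of V "(1 / l) *\<^sub>R (a - b)"] l by (simp add: power_divide)
  then have 2: "\<alpha>\<^sup>2 * (norm (V + (1 / l) *\<^sub>R (a - b)))\<^sup>2
      \<le> \<alpha>\<^sup>2 * (2 * (norm V)\<^sup>2 + (4 / l\<^sup>2) * ((norm a)\<^sup>2 + (norm b)\<^sup>2))"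
    by (intro mult_left_mono) auto
  have 1: "(\<alpha> / l) * (2 * (a \<bullet> b)) \<le> (\<alpha> / l) * (h * (norm a)\<^sup>2 + (norm b)\<^sup>2 / h)"
    using amgm \<alpha> l by (intro mult_left_mono) auto
  define u where "u = V + (1 / l) *\<^sub>R (a - b)"
  have ua: "u \<bullet> a = V \<bullet> a + (norm a)\<^sup>2 / l - (a \<bullet> b) / l"
    by (simp add: u_def inner_simps inner_commute power2_norm_eq_inner diff_divide_distrib)
  have "(norm (a - \<alpha> *\<^sub>R u))\<^sup>2 = (norm a)\<^sup>2 - 2 * \<alpha> * (u \<bullet> a) + \<alpha>\<^sup>2 * (norm u)\<^sup>2"
    by (simp only: power2_norm_eq_inner) (simp add: inner_simps inner_commute power2_eq_square algebra_simps)
  also have "\<dots> = (norm a)\<^sup>2 - 2 * \<alpha> * (V \<bullet> a) - (2 * \<alpha> / l) * (norm a)\<^sup>2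
      + (\<alpha> / l) * (2 * (a \<bullet> b)) + \<alpha>\<^sup>2 * (norm u)\<^sup>2"
    unfolding ua by (simp add: algebra_simps)
  finally show ?thesis using 1 2 unfolding u_def h_def by linarith
qed

text \<open>The pointwise estimate is integrated with \<open>z s - a\<close> and
  \<open>x s - a\<close> as its two vectors, \<open>a\<close> now being the solution. The moment
  bound is stated in \<open>norm (z s)\<close>; passing to the distance from \<open>a\<close>
  doubles it, whence \<open>4 * M1\<^sup>2\<close> and the term with \<open>norm a\<close>.\<close>

lemma (in prob_space) regularized_step_expectation:
  fixes x z V :: "'a \<Rightarrow> 'b::euclidean_space" and a :: 'b
  assumes l: "l > 0" and \<sigma>: "\<sigma> > 0" and \<alpha>: "\<alpha> \<ge> 0"
    and [measurable]: "x \<in> borel_measurable M" "z \<in> borel_measurable M" "V \<in> borel_measurable M"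
    and xi: "integrable M (\<lambda>s. (norm (x s - a))\<^sup>2)"
    and zi: "integrable M (\<lambda>s. (norm (z s - a))\<^sup>2)"
    and Vi: "integrable M (\<lambda>s. (norm (V s))\<^sup>2)"
    and VM: "(\<integral>s. (norm (V s))\<^sup>2 \<partial>M) \<le> M1\<^sup>2 * (\<integral>s. (norm (z s))\<^sup>2 \<partial>M) + M2\<^sup>2"
    and Vai: "integrable M (\<lambda>s. V s \<bullet> (z s - a))"
    and Va: "(\<integral>s. V s \<bullet> (z s - a) \<partial>M) \<ge> \<sigma> * (\<integral>s. (norm (z s - a))\<^sup>2 \<partial>M)"
  defines "z' \<equiv> (\<lambda>s. z s - \<alpha> *\<^sub>R (V s + (1 / l) *\<^sub>R (z s - x s)))"
    and "c \<equiv> (1 + \<sigma> * l) / l"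
  shows "integrable M (\<lambda>s. (norm (z' s - a))\<^sup>2)"
    and "(\<integral>s. (norm (z' s - a))\<^sup>2 \<partial>M)
      \<le> (1 - \<alpha> * c + \<alpha>\<^sup>2 * (4 * M1\<^sup>2 + 4 / l\<^sup>2)) * (\<integral>s. (norm (z s - a))\<^sup>2 \<partial>M)
        + \<alpha> * c * (1 / (1 + \<sigma> * l)\<^sup>2) * (\<integral>s. (norm (x s - a))\<^sup>2 \<partial>M)
        + \<alpha>\<^sup>2 * (4 / l\<^sup>2 * (\<integral>s. (norm (x s - a))\<^sup>2 \<partial>M) + 4 * M1\<^sup>2 * (norm a)\<^sup>2 + 2 * M2\<^sup>2)"
proof -
  let ?u = "\<lambda>s. (norm (z s - a))\<^sup>2 - 2 * \<alpha> * (V s \<bullet> (z s - a)) - (2 * \<alpha> / l) * (norm (z s - a))\<^sup>2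
      + (\<alpha> / l) * ((1 + \<sigma> * l) * (norm (z s - a))\<^sup>2 + (norm (x s - a))\<^sup>2 / (1 + \<sigma> * l))
      + \<alpha>\<^sup>2 * (2 * (norm (V s))\<^sup>2 + (4 / l\<^sup>2) * ((norm (z s - a))\<^sup>2 + (norm (x s - a))\<^sup>2))"
  let ?e = "\<integral>s. (norm (z s - a))\<^sup>2 \<partial>M" and ?R = "\<integral>s. (norm (x s - a))\<^sup>2 \<partial>M"
  have [measurable]: "z' \<in> borel_measurable M" unfolding z'_def by measurable
  have le: "(norm (z' s - a))\<^sup>2 \<le> ?u s" for s
    using regularized_step_norm_sq[OF l \<sigma> \<alpha>, of "z s - a" "V s" "x s - a"]
    by (simp add: z'_def algebra_simps)
  have ui: "integrable M ?u" using xi zi Vi Vai by simp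
  show z'i: "integrable M (\<lambda>s. (norm (z' s - a))\<^sup>2)"
  proof (rule Bochner_Integration.integrable_bound[OF ui])
    show "AE s in M. norm ((norm (z' s - a))\<^sup>2) \<le> norm (?u s)"
      using le by (intro AE_I2) (smt (verit) real_norm_def zero_le_power2)
  qed simp
  have z2i: "integrable M (\<lambda>s. (norm (z s))\<^sup>2)"
    using integrable_norm_sq_add[of "\<lambda>s. z s - a" "\<lambda>_. a"] zi by simp
  have "(\<integral>s. (norm (z s))\<^sup>2 \<partial>M) \<le> (\<integral>s. 2 * (norm (z s - a))\<^sup>2 + 2 * (norm a)\<^sup>2 \<partial>M)"
    using z2i zi norm_add_sq_le[of "z _ - a" a] by (intro integral_mono) auto
  also have "\<dots> = 2 * ?e + 2 * (norm a)\<^sup>2" using zi by (simp add: prob_space)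
  finally have "M1\<^sup>2 * (\<integral>s. (norm (z s))\<^sup>2 \<partial>M) \<le> M1\<^sup>2 * (2 * ?e + 2 * (norm a)\<^sup>2)"
    by (intro mult_left_mono) auto
  then have V2: "(\<integral>s. (norm (V s))\<^sup>2 \<partial>M) \<le> M1\<^sup>2 * (2 * ?e + 2 * (norm a)\<^sup>2) + M2\<^sup>2"
    using VM by linarith
  have "(\<integral>s. (norm (z' s - a))\<^sup>2 \<partial>M) \<le> (\<integral>s. ?u s \<partial>M)"
    using z'i ui le by (rule integral_mono)
  also have "\<dots> = ?e - 2 * \<alpha> * (\<integral>s. V s \<bullet> (z s - a) \<partial>M) - (2 * \<alpha> / l) * ?e
      + (\<alpha> / l) * ((1 + \<sigma> * l) * ?e + ?R / (1 + \<sigma> * l))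
      + \<alpha>\<^sup>2 * (2 * (\<integral>s. (norm (V s))\<^sup>2 \<partial>M) + (4 / l\<^sup>2) * (?e + ?R))"
    using xi zi Vi Vai by simp
  also have "\<dots> \<le> ?e - 2 * \<alpha> * (\<sigma> * ?e) - (2 * \<alpha> / l) * ?e
      + (\<alpha> / l) * ((1 + \<sigma> * l) * ?e + ?R / (1 + \<sigma> * l))
      + \<alpha>\<^sup>2 * (2 * (M1\<^sup>2 * (2 * ?e + 2 * (norm a)\<^sup>2) + M2\<^sup>2) + (4 / l\<^sup>2) * (?e + ?R))"
    using V2 Va \<alpha> l \<sigma> by (intro add_mono diff_mono mult_left_mono) auto
  also have "\<dots> = (1 - \<alpha> * c + \<alpha>\<^sup>2 * (4 * M1\<^sup>2 + 4 / l\<^sup>2)) * ?e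
        + \<alpha> * c * (1 / (1 + \<sigma> * l)\<^sup>2) * ?R
        + \<alpha>\<^sup>2 * (4 / l\<^sup>2 * ?R + 4 * M1\<^sup>2 * (norm a)\<^sup>2 + 2 * M2\<^sup>2)"
  proof -
    define h where "h = 1 + \<sigma> * l"
    have h: "h > 0" using l \<sigma> unfolding h_def by (simp add: add_pos_pos)
    have 1: "\<alpha> * c * (1 / h\<^sup>2) * ?R = (\<alpha> / l) * (?R / h)"
      using h l by (simp add: c_def h_def[symmetric] power2_eq_square)
    have 2: "\<alpha> * c * ?e = 2 * \<alpha> * (\<sigma> * ?e) + (2 * \<alpha> / l) * ?e - (\<alpha> / l) * (h * ?e)"
      using l by (simp add: c_def h_def field_simps)
    show ?thesis
      using 1 2 unfolding h_def[symmetric] by (simp add: algebra_simps)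
  qed
  finally show "(\<integral>s. (norm (z' s - a))\<^sup>2 \<partial>M)
      \<le> (1 - \<alpha> * c + \<alpha>\<^sup>2 * (4 * M1\<^sup>2 + 4 / l\<^sup>2)) * ?e
        + \<alpha> * c * (1 / (1 + \<sigma> * l)\<^sup>2) * ?R
        + \<alpha>\<^sup>2 * (4 / l\<^sup>2 * ?R + 4 * M1\<^sup>2 * (norm a)\<^sup>2 + 2 * M2\<^sup>2)" .
qed

text \<open>The value \<open>\<beta> * R\<close> is the fixed point of the recursion without its
  second-order terms, so the excess \<open>e j - \<beta> * R\<close> obeys the stochastic
  approximation recursion with \<open>p = \<theta> * c\<close>, and \<open>\<theta> > l\<close>
  gives \<open>p > 1\<close>. \<open>K1\<close> and \<open>K2\<close> are chosen before
  \<open>e\<close>, \<open>R\<close> and \<open>n\<close>, hence serve every outer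
  iteration.\<close>

lemma inner_loop_rate:
  fixes l \<sigma> \<theta> A B C :: real
  assumes l: "l > 0" and \<sigma>: "\<sigma> > 0" and \<theta>: "\<theta> > l" and A: "A \<ge> 0" and B: "B \<ge> 0" and C: "C \<ge> 0"
  defines "c \<equiv> (1 + \<sigma> * l) / l" and "\<beta> \<equiv> 1 / (1 + \<sigma> * l)\<^sup>2"
  obtains K1 K2 where "K1 \<ge> 0" "K2 \<ge> 0"
    "\<And>e R n. \<lbrakk>\<And>j. e j \<ge> 0; e 0 = R; n \<ge> 1;
        \<And>j. j < n \<Longrightarrow> e (Suc j) \<le> (1 - (\<theta> / (j + 1)) * c + (\<theta> / (j + 1))\<^sup>2 * A) * e j
          + (\<theta> / (j + 1)) * c * \<beta> * R + (\<theta> / (j + 1))\<^sup>2 * (B * R + C)\<rbrakk>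
      \<Longrightarrow> e n \<le> \<beta> * R + (K1 * R + K2) / real n"
proof -
  have sl: "\<sigma> * l > 0" using \<sigma> l by simp
  \<comment> \<open>The extra \<open>c\<^sup>2\<close> keeps the factor \<open>1 - t * c + t\<^sup>2 * A'\<close> nonnegative for early, large steps \<open>t\<close>.\<close>
  define A' where "A' = A + c\<^sup>2"
  define p where "p = \<theta> * c"
  have c: "c > 0" using sl l by (simp add: c_def)
  have \<beta>: "0 \<le> \<beta>" "\<beta> \<le> 1" using sl by (auto simp: \<beta>_def)
  have "1 < \<theta> / l" using \<theta> l by simp
  also have "\<dots> \<le> \<theta> / l * (1 + \<sigma> * l)" using sl \<theta> l mult_left_mono[of 1 "1 + \<sigma> * l" "\<theta> / l"] by simp
  finally have p: "p > 1" by (simp add: p_def c_def)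
  have A': "\<theta>\<^sup>2 * A' \<ge> 0" using A by (simp add: A'_def)
  obtain L where L: "L > 0" and rate: "\<And>w X m. \<lbrakk>X \<ge> 0; w 0 \<le> X; m \<ge> 1;
        \<And>j. j < m \<Longrightarrow> w (Suc j) \<le> (1 - p / (j + 1) + \<theta>\<^sup>2 * A' / (j + 1)\<^sup>2) * w j + X / (real j + 1)\<^sup>2;
        \<And>j. j < m \<Longrightarrow> 1 - p / (j + 1) + \<theta>\<^sup>2 * A' / (j + 1)\<^sup>2 \<ge> 0\<rbrakk> \<Longrightarrow> w m \<le> L * X / real m"
    using stochastic_approximation_rate[OF p A'] by metis
  show ?thesis
  proof (rule that[of "L * (1 + \<theta>\<^sup>2 * (A' + B))" "L * (\<theta>\<^sup>2 * C)"])
    show "L * (1 + \<theta>\<^sup>2 * (A' + B)) \<ge> 0" "L * (\<theta>\<^sup>2 * C) \<ge> 0"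
      using L A B C by (auto simp: A'_def)
    fix e :: "nat \<Rightarrow> real" and R :: real and n :: nat
    assume e: "\<And>j. e j \<ge> 0" and R: "e 0 = R" and n: "n \<ge> 1"
      and rec: "\<And>j. j < n \<Longrightarrow> e (Suc j) \<le> (1 - (\<theta> / (j + 1)) * c + (\<theta> / (j + 1))\<^sup>2 * A) * e j
          + (\<theta> / (j + 1)) * c * \<beta> * R + (\<theta> / (j + 1))\<^sup>2 * (B * R + C)"
    have Rpos: "R \<ge> 0" using e[of 0] R by simp
    \<comment> \<open>\<open>X\<close> has to dominate the initial excess, which is at most
      \<open>R\<close>, and the noise
      \<open>\<theta>\<^sup>2 * (A' * \<beta> * R + B * R + C)\<close>. The term with
      \<open>A'\<close> appears when \<open>e j\<close> is rewritten as
      \<open>w j + \<beta> * R\<close>; its factor \<open>\<beta>\<close> is bounded by 1.\<close>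
    define X where "X = (1 + \<theta>\<^sup>2 * (A' + B)) * R + \<theta>\<^sup>2 * C"
    define w where "w j = e j - \<beta> * R" for j
    have X: "X \<ge> 0" using Rpos A B C by (simp add: X_def A'_def)
    have XR: "R \<le> X" using Rpos A B C by (simp add: X_def A'_def algebra_simps)
    have "w n \<le> L * X / real n"
    proof (rule rate[OF X _ n])
      show "w 0 \<le> X" 
        using XR mult_nonneg_nonneg[OF \<beta>(1) Rpos] R by (simp add: w_def)
    next
      fix j assume "j < n"
      define t where "t = \<theta> / (j + 1)"
      have co: "1 - p / (j + 1) + \<theta>\<^sup>2 * A' / (j + 1)\<^sup>2 = 1 - t * c + t\<^sup>2 * A'"
        by (simp add: t_def p_def power_divide)
      \<comment> \<open>Completing the square in \<open>1 - t * c + t\<^sup>2 * c\<^sup>2\<close>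
        leaves a sum of squares, whatever the size of \<open>t\<close>.\<close>
      have "0 \<le> (1 - t * c / 2)\<^sup>2 + 3 / 4 * (t * c)\<^sup>2 + t\<^sup>2 * A" using A by simp
      also have "\<dots> = 1 - t * c + t\<^sup>2 * A'"
        by (simp add: A'_def power2_eq_square algebra_simps)
      finally show "1 - p / (j + 1) + \<theta>\<^sup>2 * A' / (j + 1)\<^sup>2 \<ge> 0" unfolding co .
      have "e (Suc j) \<le> (1 - t * c + t\<^sup>2 * A) * e j + t * c * \<beta> * R + t\<^sup>2 * (B * R + C)"
        using rec[OF \<open>j < n\<close>] by (simp add: t_def)
      also have "\<dots> \<le> (1 - t * c + t\<^sup>2 * A') * e j + t * c * \<beta> * R + t\<^sup>2 * (B * R + C)"
        using e[of j] by (intro add_right_mono mult_right_mono) (auto simp: A'_def mult_left_mono)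
      finally have "w (Suc j) \<le> (1 - t * c + t\<^sup>2 * A') * w j + t\<^sup>2 * (A' * \<beta> * R + B * R + C)"
        by (simp add: w_def algebra_simps)
      also have "t\<^sup>2 * (A' * \<beta> * R + B * R + C) \<le> X / (real j + 1)\<^sup>2"
      proof -
        have "A' * \<beta> * R \<le> A' * 1 * R"
          using \<beta> Rpos A by (intro mult_right_mono mult_left_mono) (auto simp: A'_def)
        then have "\<theta>\<^sup>2 * (A' * \<beta> * R + B * R + C) \<le> \<theta>\<^sup>2 * (A' * R + B * R + C)"
          by (intro mult_left_mono) auto
        also have "\<dots> \<le> X" using Rpos by (simp add: X_def algebra_simps)
        finally have "\<theta>\<^sup>2 * (A' * \<beta> * R + B * R + C) / (real j + 1)\<^sup>2 \<le> X / (real j + 1)\<^sup>2"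
          by (intro divide_right_mono) auto
        then show ?thesis by (simp add: t_def power_divide add.commute)
      qed
      finally show "w (Suc j) \<le> (1 - p / (j + 1) + \<theta>\<^sup>2 * A' / (j + 1)\<^sup>2) * w j + X / (real j + 1)\<^sup>2"
        unfolding co by simp
    qed
    then show "e n \<le> \<beta> * R + (L * (1 + \<theta>\<^sup>2 * (A' + B)) * R + L * (\<theta>\<^sup>2 * C)) / real n"
      by (simp add: w_def X_def algebra_simps)
  qed
qed

section \<open>Convergence rate and oracle complexity of the scheme\<close>

text \<open>Every rate \<open>r\<close> with \<open>\<rho> \<le> r\<close> and
  \<open>1 / (1 + \<sigma> * lam)\<^sup>2 < r\<close> is attained, which covers both cases of (a).
  In (b) the premise makes \<open>\<rho>\<close> itself such a rate, so the error falls at least as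
  fast as the number of calls grows. Integrability is part of the conclusion because the Bochner
  integral otherwise defaults to 0, and the existence of \<open>K\<close> because
  \<open>LEAST\<close> is uninformative without a witness.\<close>

theorem proposition8:
  fixes G :: "('p::finite, 'n::finite, 'm::finite, 'w) hier_game"
    and \<Omega> :: "'s measure"
    and \<omega> :: "nat \<Rightarrow> nat \<Rightarrow> 's \<Rightarrow> 'w"
    and v :: "real ^ 'n \<Rightarrow> 'w \<Rightarrow> real ^ 'n"
    and D :: "(real ^ 'n) set"
    and N :: "nat \<Rightarrow> nat"
    and x :: "nat \<Rightarrow> 's \<Rightarrow> real ^ 'n"
    and x0 xstar :: "real ^ 'n"
    and \<sigma> lam \<theta> \<rho> d q M M1 M2 :: real
    and err :: "nat \<Rightarrow> real"
  assumes game: "hierarchical_game G"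
    and \<sigma>: "\<sigma> > 0" "strongly_monotone_op \<sigma> (game_map G)"
    and first_order: "stochastic_oracle G D M1 M2 v"
    and params: "lam > 0" "\<theta> > lam"
    and samples: "fresh_samples \<Omega> (sample_space G) N \<omega>"
    and scheme: "\<And>k s. x k s = vrspp v lam \<theta> N x0 (\<lambda>k j. \<omega> k j s) k"
    and calls: "AE s in \<Omega>. \<forall>k. \<forall>j<N k. vrspp_inner v lam \<theta> (x k s) (\<lambda>j. \<omega> k j s) j \<in> D"
    and xstar: "0 \<in> game_map G xstar"
    and start: "norm (x0 - xstar) \<le> M"
    and \<rho>: "0 < \<rho>" "\<rho> < 1"
    and N: "\<And>k. N k = nat \<lfloor>(1 / \<rho>) ^ (k + 1)\<rfloor>"
    and q: "d > 0" "q = (1 + d) / (1 + \<sigma> * lam)\<^sup>2" "q < 1"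
    and err: "\<And>k. err k = (\<integral>s. (norm (x k s - xstar))\<^sup>2 \<partial>\<Omega>)"
  shows "(\<forall>k. integrable \<Omega> (\<lambda>s. (norm (x k s - xstar))\<^sup>2)) \<and>
    (\<forall>\<rho>'. (q \<noteq> \<rho> \<longrightarrow> \<rho>' = max q \<rho>) \<and> (q = \<rho> \<longrightarrow> q < \<rho>' \<and> \<rho>' < 1) \<longrightarrow>
        (\<exists>D'>0. \<forall>k. err k \<le> D' * \<rho>' ^ k)) \<and>
    (1 / (1 + \<sigma> * lam)\<^sup>2 < \<rho> \<longrightarrow>
        (\<forall>\<epsilon>>0. \<exists>K. err (K + 1) \<le> \<epsilon>) \<and>
        (\<lambda>\<epsilon>. real (oracle_complexity err N \<epsilon>)) \<in> O[at_right 0](\<lambda>\<epsilon>. 1 / \<epsilon>))"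
proof -
  let ?P = "sample_space G"
  define \<beta> where "\<beta> = 1 / (1 + \<sigma> * lam)\<^sup>2"
  define c where "c = (1 + \<sigma> * lam) / lam"
  define A where "A = 4 * M1\<^sup>2 + 4 / lam\<^sup>2"
  define B where "B = 4 / lam\<^sup>2"
  define C where "C = 4 * M1\<^sup>2 * (norm xstar)\<^sup>2 + 2 * M2\<^sup>2"
  have P: "prob_space ?P" using game by (rule hierarchical_game.prob_sample)
  interpret prob_space \<Omega> using samples by (simp add: fresh_samples_def)
  have ind: "indep_vars (\<lambda>_. ?P) (\<lambda>(k, j). \<omega> k j) (SIGMA k:UNIV. {..<N k})"
    and distr: "\<And>k j. j < N k \<Longrightarrow> distr \<Omega> ?P (\<omega> k j) = ?P"
    using samples by (auto simp: fresh_samples_def)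
  have w[measurable]: "\<omega> k j \<in> measurable \<Omega> ?P" if "j < N k" for k j
    using ind that unfolding indep_vars_def by force
  have v[measurable]: "(\<lambda>(x, w). v x w) \<in> borel_measurable (borel \<Otimes>\<^sub>M ?P)"
    using first_order by (simp add: stochastic_oracle_def)
  have mean: "integrable ?P (v y) \<and>
      (\<integral>w. v y w \<partial>?P) \<bullet> (y - xstar) \<ge> \<sigma> * (norm (y - xstar))\<^sup>2" if "y \<in> D" for y
  proof -
    have y: "integrable ?P (v y)" "(\<integral>w. v y w \<partial>?P) \<in> game_map G y"
      using first_order that by (auto simp: stochastic_oracle_def)
    \<comment> \<open>Strong monotonicity is applied to the mean oracle output at \<open>y\<close>
      and to the zero selection at \<open>xstar\<close>.\<close>
    then have "((\<integral>w. v y w \<partial>?P) - 0) \<bullet> (y - xstar) \<ge> \<sigma> * (norm (y - xstar))\<^sup>2"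
      using \<sigma>(2) xstar unfolding strongly_monotone_op_def by blast
    with y show ?thesis by simp
  qed
  have second: "integrable ?P (\<lambda>w. (norm (v y w))\<^sup>2) \<and>
      (\<integral>w. (norm (v y w))\<^sup>2 \<partial>?P) \<le> M1\<^sup>2 * (norm y)\<^sup>2 + M2\<^sup>2" if "y \<in> D" for y
    using first_order that by (auto simp: stochastic_oracle_def)
  define Z where "Z k j s = vrspp_inner v lam \<theta> (x k s) (\<lambda>j. \<omega> k j s) j" for k j s
  have x_meas[measurable]: "x k \<in> borel_measurable \<Omega>" for k
    unfolding scheme[abs_def] by (rule measurable_vrspp[OF v]) (auto intro: w)
  have Z_meas: "Z k j \<in> borel_measurable \<Omega>" if "j \<le> N k" for k j
    unfolding Z_def[abs_def] using that
    by (intro measurable_vrspp_inner[OF v]) (auto intro: w)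
  have Z_0: "Z k 0 = x k" for k by (simp add: Z_def[abs_def])
  have Z_N: "Z k (N k) = x (Suc k)" for k by (simp add: Z_def[abs_def] scheme[abs_def])
  have Z_Suc: "Z k (Suc j) s = Z k j s - (\<theta> / (real j + 1)) *\<^sub>R
      (v (Z k j s) (\<omega> k j s) + (1 / lam) *\<^sub>R (Z k j s - x k s))" for k j s
    by (simp add: Z_def Let_def add.commute)
  have joint: "distr \<Omega> (borel \<Otimes>\<^sub>M ?P) (\<lambda>s. (Z k j s, \<omega> k j s)) = distr \<Omega> borel (Z k j) \<Otimes>\<^sub>M ?P"
    if "j < N k" for k j
    unfolding Z_def[abs_def] scheme using distr_iterate_next_sample[OF v ind P distr[OF that] that] .
  have Z_D: "AE s in \<Omega>. Z k j s \<in> D" if "j < N k" for k j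
    using calls that unfolding Z_def by (auto elim!: eventually_mono)
  define sq where "sq k j = (\<integral>s. (norm (Z k j s - xstar))\<^sup>2 \<partial>\<Omega>)" for k j
  have sq_nonneg: "sq k j \<ge> 0" for k j unfolding sq_def by simp
  have err_sq: "err k = sq k 0" "err (Suc k) = sq k (N k)" for k
    by (simp_all add: sq_def err Z_0 Z_N)
  \<comment> \<open>The estimate for one step presupposes square integrability and hands it on to
    the next iterate, so both are proved together; the nested inductions below then discharge the
    premises.\<close>
  have step: "integrable \<Omega> (\<lambda>s. (norm (Z k (Suc j) s - xstar))\<^sup>2) \<and>
      sq k (Suc j) \<le> (1 - (\<theta> / (j + 1)) * c + (\<theta> / (j + 1))\<^sup>2 * A) * sq k j
        + (\<theta> / (j + 1)) * c * \<beta> * err k + (\<theta> / (j + 1))\<^sup>2 * (B * err k + C)"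
    if j: "j < N k" and xi: "integrable \<Omega> (\<lambda>s. (norm (x k s - xstar))\<^sup>2)"
      and zi: "integrable \<Omega> (\<lambda>s. (norm (Z k j s - xstar))\<^sup>2)" for k j
  proof -
    have [measurable]: "Z k j \<in> borel_measurable \<Omega>" using Z_meas j by simp
    have z2i: "integrable \<Omega> (\<lambda>s. (norm (Z k j s))\<^sup>2)"
      using integrable_norm_sq_add[of "\<lambda>s. Z k j s - xstar" "\<lambda>_. xstar"] zi by simp
    note call = random_oracle_call[OF v mean second P _ w[OF j] joint[OF j] Z_D[OF j] z2i]
    have V[measurable]: "(\<lambda>s. v (Z k j s) (\<omega> k j s)) \<in> borel_measurable \<Omega>"
      using measurable_compose[OF _ v, of "\<lambda>s. (Z k j s, \<omega> k j s)" \<Omega>] w[OF j] by simp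
    have \<alpha>: "\<theta> / (real j + 1) \<ge> 0" using params by simp
    note st = regularized_step_expectation[OF params(1) \<sigma>(1) \<alpha> x_meas _ V xi zi call]
    show ?thesis
      using st unfolding Z_Suc sq_def err A_def B_def C_def \<beta>_def c_def
      by (simp add: add.assoc add.commute[of 1])
  qed
  have x_int: "integrable \<Omega> (\<lambda>s. (norm (x k s - xstar))\<^sup>2)" for k
  proof (induction k)
    case 0
    then show ?case by (simp add: scheme)
  next
    case (Suc k)
    have "integrable \<Omega> (\<lambda>s. (norm (Z k j s - xstar))\<^sup>2)" if "j \<le> N k" for j
      using that
    proof (induction j)
      case 0
      then show ?case using \<open>integrable \<Omega> (\<lambda>s. (norm (x k s - xstar))\<^sup>2)\<close> by (simp add: Z_0)
    next
      case (Suc j)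
      then show ?case using step[of j k] \<open>integrable \<Omega> (\<lambda>s. (norm (x k s - xstar))\<^sup>2)\<close> by simp
    qed
    from this[of "N k"] show ?case by (simp add: Z_N)
  qed
  have Z_int: "integrable \<Omega> (\<lambda>s. (norm (Z k j s - xstar))\<^sup>2)" if "j \<le> N k" for k j
    using that by (induction j) (use x_int step in \<open>auto simp: Z_0\<close>)
  have ABC: "A \<ge> 0" "B \<ge> 0" "C \<ge> 0" by (simp_all add: A_def B_def C_def)
  obtain K1 K2 where K: "K1 \<ge> 0" "K2 \<ge> 0"
    and rate: "\<And>e R n. \<lbrakk>\<And>j. e j \<ge> 0; e 0 = R; n \<ge> 1;
        \<And>j. j < n \<Longrightarrow> e (Suc j) \<le> (1 - (\<theta> / (j + 1)) * c + (\<theta> / (j + 1))\<^sup>2 * A) * e j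
          + (\<theta> / (j + 1)) * c * \<beta> * R + (\<theta> / (j + 1))\<^sup>2 * (B * R + C)\<rbrakk>
      \<Longrightarrow> e n \<le> \<beta> * R + (K1 * R + K2) / real n"
    using inner_loop_rate[OF params(1) \<sigma>(1) params(2) ABC] unfolding c_def \<beta>_def by metis
  \<comment> \<open>As \<open>\<rho> < 1\<close>, the floor is at least 1, so every inner loop makes
    a step and \<open>rate\<close> applies. Then \<open>?r < N k + 1 \<le> 2 * N k\<close>, so
    rounding down costs a factor 2 only.\<close>
  have Nk: "real (N k) \<le> (1 / \<rho>) ^ Suc k" "N k \<ge> 1" "1 / real (N k) \<le> 2 * \<rho> ^ k" for k
  proof -
    let ?r = "(1 / \<rho>) ^ Suc k"
    have r: "?r \<ge> 1" using \<rho> by (intro one_le_power) simp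
    have N': "real (N k) = of_int \<lfloor>?r\<rfloor>" using r by (simp add: N)
    then show "real (N k) \<le> ?r" by simp
    have "\<lfloor>?r\<rfloor> \<ge> 1" using r by (simp only: one_le_floor)
    then have N1: "real (N k) \<ge> 1" using N' by (simp only: of_int_1_le_iff)
    then show "N k \<ge> 1" by simp
    have "?r < real (N k) + 1" unfolding N' by linarith
    then have "?r \<le> 2 * real (N k)" using N1 by linarith
    then have "1 / real (N k) \<le> 2 * \<rho> ^ Suc k"
      using \<rho> N1 by (simp add: power_divide divide_simps mult_ac)
    also have "\<dots> \<le> 2 * \<rho> ^ k" using \<rho> by (intro mult_left_mono power_decreasing) auto
    finally show "1 / real (N k) \<le> 2 * \<rho> ^ k" .
  qed
  have err_nonneg: "err k \<ge> 0" for k by (simp add: err)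
  \<comment> \<open>The inner-loop error of order \<open>1 / N k\<close> becomes one of order
    \<open>\<rho> ^ k\<close>, both relative and absolute.\<close>
  have outer: "err (Suc k) \<le> (\<beta> + (2 * K1) * \<rho> ^ k) * err k + (2 * K2) * \<rho> ^ k" for k
  proof -
    have "err (Suc k) \<le> \<beta> * err k + (K1 * err k + K2) / real (N k)"
      unfolding err_sq(2) using step x_int Z_int Nk(2)
      by (intro rate sq_nonneg) (auto simp: err_sq(1))
    also have "(K1 * err k + K2) / real (N k) = (K1 * err k + K2) * (1 / real (N k))" by simp
    also have "\<dots> \<le> (K1 * err k + K2) * (2 * \<rho> ^ k)"
      using Nk(3) K err_nonneg[of k] by (intro mult_left_mono) auto
    finally show ?thesis by (simp add: algebra_simps)
  qed
  have sl: "1 + \<sigma> * lam > 0" using \<sigma>(1) params by (simp add: add_pos_pos)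
  \<comment> \<open>\<open>d > 0\<close> puts \<open>\<beta>\<close> strictly below
    \<open>q\<close>; this gap is what admits the rate \<open>q\<close> itself when
    \<open>\<rho> < q\<close>.\<close>
  have \<beta>q: "0 \<le> \<beta>" "\<beta> < q"
    using q sl unfolding \<beta>_def by (auto intro!: divide_strict_right_mono)
  have linear: "\<exists>C>0. \<forall>k. err k \<le> C * r ^ k" if "\<rho> \<le> r" "\<beta> < r" for r
    using perturbed_linear_rate[OF err_nonneg outer \<rho> that(1) \<beta>q(1) that(2)] K by simp
  show ?thesis
  proof (intro conjI allI impI)
    show "integrable \<Omega> (\<lambda>s. (norm (x k s - xstar))\<^sup>2)" for k by (rule x_int)
  next
    fix r assume "(q \<noteq> \<rho> \<longrightarrow> r = max q \<rho>) \<and> (q = \<rho> \<longrightarrow> q < r \<and> r < 1)"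
    then have "\<rho> \<le> r" "\<beta> < r" using \<beta>q by (auto simp: max_def split: if_splits)
    then show "\<exists>D'>0. \<forall>k. err k \<le> D' * r ^ k" by (rule linear)
  next
    assume "1 / (1 + \<sigma> * lam)\<^sup>2 < \<rho>"
    then obtain C' where C': "C' > 0" "\<And>k. err k \<le> C' * \<rho> ^ k"
      using linear[of \<rho>] by (auto simp: \<beta>_def)
    note bigo = oracle_complexity_bigo[OF \<rho> C' Nk(1)]
    show "\<exists>K. err (K + 1) \<le> \<epsilon>" if "\<epsilon> > 0" for \<epsilon> using bigo(1) that by blast
    show "(\<lambda>\<epsilon>. real (oracle_complexity err N \<epsilon>)) \<in> O[at_right 0](\<lambda>\<epsilon>. 1 / \<epsilon>)" by (rule bigo(2))
  qed
qed

end
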